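(* Let $n,t\ge 0$ be integers, let $[p,q]$ be a compact real interval, let $x,x_0,x_1,\dots,x_n\in[p,q]$ be distinct numbers, and let $f\in C^{n+t+1}[p,q]$. Let $I$ be the smallest closed interval containing $x,x_0,\dots,x_n$, and let $N_r(x)$, $\tilde N^{(r)}_{0,1,\dots,n}[x]$, $A_r(x)$, $\tilde A^{(r)}_{0,1,\dots,n}[x]$ be as defined in the context; write $N_r=N_r(x)$ and $A_r=A_r(x)$. (i) Define $a_0=1$ and $a_k=-(a_0N_k+a_1N_{k-1}+a_2N_{k-2}+\dots+a_{k-1}N_1)$ for $k=1,\dots,t$. Then there exist $\xi_0,\xi_1,\dots,\xi_t\in I$ such that $$\frac{f^{(t)}(x)}{t!}=a_0\tilde N^{(t)}_{0,1,\dots,n}[x]+a_1\tilde N^{(t-1)}_{0,1,\dots,n}[x]+\dots+a_t\tilde N^{(0)}_{0,1,\dots,n}[x]+\prod_{i=0}^{n}(x-x_i)\left(a_0\frac{f^{(t+n+1)}(\xi_0)}{(t+n+1)!}+a_1\frac{f^{(t+n)}(\xi_1)}{(t+n)!}+\dots+a_t\frac{f^{(n+1)}(\xi_t)}{(n+1)!}\right).$$ (ii) Define instead $a_0=1$ and $a_k=-(a_0A_k+a_1A_{k-1}+a_2A_{k-2}+\dots+a_{k-1}A_1)$ for $k=1,\dots,t$. Then there exist $\xi_0,\xi_1,\dots,\xi_t\in I$ such that $$\frac{f^{(t)}(x)}{t!}=a_0\tilde A^{(t)}_{0,1,\dots,n}[x]+a_1\tilde A^{(t-1)}_{0,1,\dots,n}[x]+\dots+a_t\tilde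 A^{(0)}_{0,1,\dots,n}[x]+\prod_{i=0}^{n}(x-x_i)\left(a_0\frac{f^{(t+n+1)}(\xi_0)}{(t+n+1)!}+a_1\frac{f^{(t+n)}(\xi_1)}{(t+n)!}+\dots+a_t\frac{f^{(n+1)}(\xi_t)}{(n+1)!}\right).$$
   Context: For an integer $r\ge 0$ define the following quantities, where vertical bars denote $2\times2$ determinants. Neville scheme: for $j=0,\dots,n$ put $N^{(r)}_j[x]=\dfrac{1}{(x_j-x)^r}$ and $\tilde N^{(r)}_j[x]=\dfrac{f(x_j)}{(x_j-x)^r}$. For $i=1,\dots,n$ and $j=0,\dots,n-i$ put $$N^{(r)}_{j,j+1,\dots,i+j}[x]=\frac{1}{x_{i+j}-x_j}\begin{vmatrix} N^{(r)}_{j,j+1,\dots,i+j-1}[x] & x_j-x\\ N^{(r)}_{j+1,j+2,\dots,i+j}[x] & x_{i+j}-x\end{vmatrix},$$ and define $\tilde N^{(r)}_{j,j+1,\dots,i+j}[x]$ by the same recursion with $\tilde N$ in place of $N$. Set $N_r(x)=N^{(r)}_{0,1,\dots,n}[x]$. Aitken scheme: for $j=0,\dots,n$ put $A^{(r)}_j[x]=\dfrac{1}{(x_j-x)^r}$ and $\tilde A^{(r)}_j[x]=\dfrac{f(x_j)}{(x_j-x)^r}$. For $i=0,\dots,n-1$ and $j=i+1,\dots,n$ put $$A^{(r)}_{0,1,\dots,i-1,i,j}[x]=\frac{1}{x_j-x_i}\begin{vmatrix} A^{(r)}_{0,1,\dots,i-1,i}[x] & x_i-x\\ A^{(r)}_{0,1,\dots,i-1,j}[x]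 & x_j-x\end{vmatrix}$$ (for $i=0$ the first column consists of $A^{(r)}_0[x]$ and $A^{(r)}_j[x]$), and define $\tilde A^{(r)}_{0,1,\dots,i,j}[x]$ by the same recursion with $\tilde A$ in place of $A$. Set $A_r(x)=A^{(r)}_{0,1,\dots,n}[x]$. *)

theory Defs
  imports "HOL-Analysis.Analysis"
begin

text \<open>
  Iterated derivatives relative to a set \<open>S\<close>: for a nondegenerate interval \<open>S = {p..q}\<close> these are
  the usual derivatives, one-sided at the end points, and depend on \<open>f\<close> only through its values
  on \<open>S\<close>.
\<close>

primrec nderiv_on :: "real set \<Rightarrow> nat \<Rightarrow> (real \<Rightarrow> real) \<Rightarrow> real \<Rightarrow> real" where
  "nderiv_on S 0 f = f"
| "nderiv_on S (Suc k) f = (\<lambda>y. vector_derivative (nderiv_on S k f) (at y within S))"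

definition Ck_on :: "nat \<Rightarrow> real set \<Rightarrow> (real \<Rightarrow> real) \<Rightarrow> bool" where
  "Ck_on k S f \<longleftrightarrow>
     (\<forall>i<k. nderiv_on S i f differentiable_on S) \<and> continuous_on S (nderiv_on S k f)"

definition smallest_closed_interval :: "real set \<Rightarrow> real set" where
  "smallest_closed_interval X = \<Inter> {J. (\<exists>a b. J = {a..b}) \<and> X \<subseteq> J}"

lemma smallest_closed_interval_eq:
  assumes "finite X" "X \<noteq> {}"
  shows "smallest_closed_interval X = {Min X..Max X}"
proof
  have "X \<subseteq> {Min X..Max X}"
    using assms by auto
  then show "smallest_closed_interval X \<subseteq> {Min X..Max X}"
    unfolding smallest_closed_interval_def by blast
  show "{Min X..Max X} \<subseteq> smallest_closed_interval X"
  proof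
    fix y assume y: "y \<in> {Min X..Max X}"
    have "y \<in> {a..b}" if "X \<subseteq> {a..b}" for a b
      using y that Min_in[OF assms] Max_in[OF assms] by fastforce
    then show "y \<in> smallest_closed_interval X"
      unfolding smallest_closed_interval_def by blast
  qed
qed

definition det22 :: "real \<Rightarrow> real \<Rightarrow> real \<Rightarrow> real \<Rightarrow> real" where
  "det22 a b c d = det (vector [vector [a, b], vector [c, d]] :: real^2^2)"

text \<open>
  For a zeroth column \<open>c 0, c 1, \<dots>\<close>, \<open>neville xs x c i j\<close> is the entry of the Neville table with
  index list \<open>j, j+1, \<dots>, i+j\<close>, and \<open>aitken xs x c i j\<close> (for \<open>i \<le> j\<close>) is the entry of the Aitken
  table with index list \<open>0, 1, \<dots>, i-1, j\<close>.  In particular, the index list \<open>0, 1, \<dots>, n\<close>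
  corresponds to \<open>neville xs x c n 0\<close> and to \<open>aitken xs x c n n\<close>.
\<close>

primrec neville :: "(nat \<Rightarrow> real) \<Rightarrow> real \<Rightarrow> (nat \<Rightarrow> real) \<Rightarrow> nat \<Rightarrow> nat \<Rightarrow> real" where
  "neville xs x c 0 j = c j"
| "neville xs x c (Suc i) j =
     1 / (xs (Suc i + j) - xs j) *
     det22 (neville xs x c i j)       (xs j - x)
           (neville xs x c i (Suc j)) (xs (Suc i + j) - x)"

primrec aitken :: "(nat \<Rightarrow> real) \<Rightarrow> real \<Rightarrow> (nat \<Rightarrow> real) \<Rightarrow> nat \<Rightarrow> nat \<Rightarrow> real" where
  "aitken xs x c 0 j = c j"
| "aitken xs x c (Suc i) j =
     1 / (xs j - xs i) *
     det22 (aitken xs x c i i) (xs i - x)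
           (aitken xs x c i j) (xs j - x)"

definition N_val :: "(nat \<Rightarrow> real) \<Rightarrow> nat \<Rightarrow> real \<Rightarrow> nat \<Rightarrow> real" where
  "N_val xs n x r = neville xs x (\<lambda>j. 1 / (xs j - x) ^ r) n 0"

definition N_tilde :: "(real \<Rightarrow> real) \<Rightarrow> (nat \<Rightarrow> real) \<Rightarrow> nat \<Rightarrow> real \<Rightarrow> nat \<Rightarrow> real" where
  "N_tilde f xs n x r = neville xs x (\<lambda>j. f (xs j) / (xs j - x) ^ r) n 0"

definition A_val :: "(nat \<Rightarrow> real) \<Rightarrow> nat \<Rightarrow> real \<Rightarrow> nat \<Rightarrow> real" where
  "A_val xs n x r = aitken xs x (\<lambda>j. 1 / (xs j - x) ^ r) n n"

definition A_tilde :: "(real \<Rightarrow> real) \<Rightarrow> (nat \<Rightarrow> real) \<Rightarrow> nat \<Rightarrow> real \<Rightarrow> nat \<Rightarrow> real" where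
  "A_tilde f xs n x r = aitken xs x (\<lambda>j. f (xs j) / (xs j - x) ^ r) n n"

text \<open>The coefficients \<open>a\<^sub>k\<close> determined by a sequence \<open>M 1, M 2, \<dots>\<close>; \<open>M 0\<close> is not used.\<close>

fun coeff_a :: "(nat \<Rightarrow> real) \<Rightarrow> nat \<Rightarrow> real" where
  "coeff_a M k = (if k = 0 then 1 else - (\<Sum>j<k. coeff_a M j * M (k - j)))"

declare coeff_a.simps [simp del]

end

theory Submission
  imports Defs
begin

text \<open>
  Both schemes evaluate at \<open>x\<close> the interpolation polynomial of their zeroth column.
  Let \<open>F\<^sub>s = f\<^sup>(\<^sup>s\<^sup>)(x) / s!\<close> and \<open>r \<le> t\<close>.  Generalised Rolle for \<open>f\<close> minus its Hermite interpolant
  (order \<open>r + 1\<close> at \<open>x\<close>, simple nodes \<open>x\<^sub>0, \<dots>, x\<^sub>n\<close>) gives \<open>\<xi>\<close> with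
  \<open>(\<Sum>s\<le>r. F\<^sub>s * N\<^sub>r\<^sub>-\<^sub>s) = \<tilde>N\<^sub>r + (\<Prod>i\<le>n. x - x\<^sub>i) * f\<^sup>(\<^sup>r\<^sup>+\<^sup>n\<^sup>+\<^sup>1\<^sup>)(\<xi>) / (r + n + 1)!\<close>.
  The \<open>a\<^sub>k\<close> are the coefficients of the reciprocal of the power series \<open>\<Sum>N\<^sub>k z\<^sup>k\<close>, so
  convolving these relations with \<open>a\<close> isolates \<open>F\<^sub>t\<close>.
\<close>

lemma det22_eq: "det22 a b c d = a * d - b * c"
  by (simp add: det22_def det_2)

subsection \<open>Interpolation\<close>

text \<open>Polynomials are written in the shifted variable \<open>y - x\<close>, so the value at \<open>x\<close> is the value at \<open>0\<close>.\<close>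

lemma interpolation_step:
  fixes P Q :: "real poly" and u v :: real
  assumes "degree P \<le> m" "degree Q \<le> m" "u \<noteq> v"
  defines "R \<equiv> smult (1 / (v - u)) (P * [:v, -1:] - Q * [:u, -1:])"
  shows "degree R \<le> Suc m"
    and "poly R y = (poly P y * (v - y) - poly Q y * (u - y)) / (v - u)"
proof -
  have "degree (P * [:v, -1:]) \<le> Suc m" "degree (Q * [:u, -1:]) \<le> Suc m"
    using degree_mult_le[of P "[:v, -1:]"] degree_mult_le[of Q "[:u, -1:]"] assms(1,2) by auto
  then show "degree R \<le> Suc m"
    unfolding R_def by (intro order_trans[OF degree_smult_le] degree_diff_le)
  show "poly R y = (poly P y * (v - y) - poly Q y * (u - y)) / (v - u)"
    using assms(3) by (simp add: R_def field_simps)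
qed

text \<open>Induction gluing two interpolants of lower degree: \<open>P\<close> and \<open>Q\<close>
  get the weights \<open>(v - y) / (v - u)\<close> and \<open>(y - u) / (v - u)\<close>. These sum
  to 1, so values at shared nodes survive, while at \<open>u\<close> only \<open>P\<close> counts
  and at \<open>v\<close> only \<open>Q\<close>. At \<open>y = 0\<close> the combination is the
  determinant recursion.\<close>

lemma neville_interpolation:
  fixes xs c :: "nat \<Rightarrow> real"
  assumes "inj_on xs {j..i + j}"
  shows "\<exists>P. degree P \<le> i \<and> (\<forall>k\<in>{j..i + j}. poly P (xs k - x) = c k) \<and>
    poly P 0 = neville xs x c i j"
  using assms
proof (induction i arbitrary: j)
  case 0
  show ?case by (intro exI[of _ "[:c j:]"]) auto
next
  case (Suc i)
  have "inj_on xs {j..i + j}" "inj_on xs {Suc j..i + Suc j}"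
    using Suc.prems by (auto intro: inj_on_subset)
  from Suc.IH[OF this(1)] Suc.IH[OF this(2)] obtain P Q where
    P: "degree P \<le> i" "\<And>k. k \<in> {j..i + j} \<Longrightarrow> poly P (xs k - x) = c k" "poly P 0 = neville xs x c i j" and
    Q: "degree Q \<le> i" "\<And>k. k \<in> {Suc j..i + Suc j} \<Longrightarrow> poly Q (xs k - x) = c k"
       "poly Q 0 = neville xs x c i (Suc j)"
    by blast
  have ne: "xs j \<noteq> xs (Suc i + j)"
    using Suc.prems by (auto dest!: inj_onD)
  let ?u = "xs j - x" and ?v = "xs (Suc i + j) - x"
  let ?R = "smult (1 / (?v - ?u)) (P * [:?v, -1:] - Q * [:?u, -1:])"
  have uv: "?u \<noteq> ?v" using ne by simp
  note R = interpolation_step[OF P(1) Q(1) uv]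
  have "poly ?R (xs k - x) = c k" if k: "k \<in> {j..Suc i + j}" for k
  proof -
    consider "k = j" | "k = Suc i + j" | "k \<in> {Suc j..i + j}"
      using k by fastforce
    then show ?thesis
    proof cases
      case 3
      then have "poly P (xs k - x) = c k" "poly Q (xs k - x) = c k"
        by (auto intro: P(2) Q(2))
      then show ?thesis
        unfolding R(2) using ne by (simp add: field_simps)
    qed (unfold R(2), use ne P(2)[of j] Q(2)[of "Suc i + j"] in \<open>simp_all add: divide_simps\<close>, argo+)
  qed
  moreover have "poly ?R 0 = neville xs x c (Suc i) j"
    unfolding R(2) by (simp add: det22_eq P(3) Q(3) mult.commute)
  ultimately show ?case
    using R(1) by blast
qed

text \<open>Same gluing as for Neville, but the shared nodes are now those with index below
  \<open>i\<close>; \<open>P\<close> alone covers node \<open>i\<close> and \<open>Q\<close> alone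
  covers node \<open>j\<close>.\<close>

lemma aitken_interpolation:
  fixes xs c :: "nat \<Rightarrow> real"
  assumes "inj_on xs {..j}" "i \<le> j"
  shows "\<exists>P. degree P \<le> i \<and> (\<forall>k\<in>insert j {..<i}. poly P (xs k - x) = c k) \<and>
    poly P 0 = aitken xs x c i j"
  using assms
proof (induction i arbitrary: j)
  case 0
  show ?case by (intro exI[of _ "[:c j:]"]) auto
next
  case (Suc i)
  have "inj_on xs {..i}" "i \<le> j"
    using Suc.prems by (auto intro: inj_on_subset)
  from Suc.IH[OF this(1) order_refl] Suc.IH[OF Suc.prems(1) this(2)] obtain P Q where
    P: "degree P \<le> i" "\<And>k. k \<le> i \<Longrightarrow> poly P (xs k - x) = c k" "poly P 0 = aitken xs x c i i" and
    Q: "degree Q \<le> i" "\<And>k. k < i \<or> k = j \<Longrightarrow> poly Q (xs k - x) = c k" "poly Q 0 = aitken xs x c i j"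
    by (metis insert_iff lessThan_iff nat_less_le)
  have ne: "xs i \<noteq> xs j"
    using Suc.prems by (auto dest!: inj_onD)
  let ?u = "xs i - x" and ?v = "xs j - x"
  let ?R = "smult (1 / (?v - ?u)) (P * [:?v, -1:] - Q * [:?u, -1:])"
  have uv: "?u \<noteq> ?v" using ne by simp
  note R = interpolation_step[OF P(1) Q(1) uv]
  have "poly ?R (xs k - x) = c k" if k: "k \<in> insert j {..<Suc i}" for k
  proof -
    consider "k = i" | "k = j" | "k < i"
      using k by fastforce
    then show ?thesis
    proof cases
      case 3
      then have "poly P (xs k - x) = c k" "poly Q (xs k - x) = c k"
        by (auto intro: P(2) Q(2))
      then show ?thesis
        unfolding R(2) using ne by (simp add: field_simps)
    qed (unfold R(2), use ne P(2)[of i] Q(2)[of j] in \<open>simp_all add: divide_simps\<close>, argo+)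
  qed
  moreover have "poly ?R 0 = aitken xs x c (Suc i) j"
    unfolding R(2) by (simp add: det22_eq P(3) Q(3) mult.commute)
  ultimately show ?case
    using R(1) by blast
qed

lemma interpolation_unique:
  fixes P Q :: "real poly" and xs :: "nat \<Rightarrow> real"
  assumes "inj_on xs {..n}" "degree P \<le> n" "degree Q \<le> n"
    and "\<And>k. k \<le> n \<Longrightarrow> poly P (xs k - x) = poly Q (xs k - x)"
  shows "P = Q"
proof (rule poly_eqI_degree)
  have "inj_on (\<lambda>k. xs k - x) {..n}"
    using assms(1) by (simp add: inj_on_def)
  then have "card ((\<lambda>k. xs k - x) ` {..n}) = Suc n"
    by (simp add: card_image)
  then show "card ((\<lambda>k. xs k - x) ` {..n}) > degree P" "card ((\<lambda>k. xs k - x) ` {..n}) > degree Q"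
    using assms(2,3) by auto
qed (use assms(4) in auto)

text \<open>By uniqueness of interpolation, a table entry can be computed from any polynomial of
  degree at most \<open>n\<close> with the right node values.\<close>

lemma neville_eq_poly:
  fixes xs c :: "nat \<Rightarrow> real"
  assumes "inj_on xs {..n}" "degree P \<le> n" "\<And>k. k \<le> n \<Longrightarrow> poly P (xs k - x) = c k"
  shows "neville xs x c n 0 = poly P 0"
proof -
  obtain Q where Q: "degree Q \<le> n" "\<And>k. k \<le> n \<Longrightarrow> poly Q (xs k - x) = c k"
      "poly Q 0 = neville xs x c n 0"
    using neville_interpolation[of xs 0 n x c] assms(1) by (auto simp: atLeast0AtMost)
  then have "P = Q"
    using assms by (intro interpolation_unique[OF assms(1), of P Q x]) auto
  with Q(3) show ?thesis by simp
qed

text \<open>Both final entries evaluate the same interpolation polynomial; this reduces part (ii) to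
  part (i).\<close>

lemma aitken_eq_neville:
  assumes "inj_on xs {..n}"
  shows "aitken xs x c n n = neville xs x c n 0"
proof -
  obtain Q where Q: "degree Q \<le> n" "\<And>k. k \<in> insert n {..<n} \<Longrightarrow> poly Q (xs k - x) = c k"
      "poly Q 0 = aitken xs x c n n"
    using aitken_interpolation[OF assms order_refl] by blast
  have "neville xs x c n 0 = poly Q 0"
    using Q(1,2) by (intro neville_eq_poly[OF assms]) (auto simp: le_less)
  with Q(3) show ?thesis by simp
qed

section \<open>Dependence of Neville entries on the zeroth column\<close>

lemma neville_cong:
  assumes "\<And>k. k \<in> {j..i + j} \<Longrightarrow> c k = d k"
  shows "neville xs x c i j = neville xs x d i j"
  using assms
proof (induction i arbitrary: j)
  case (Suc i)
  have "neville xs x c i j = neville xs x d i j" "neville xs x c i (Suc j) = neville xs x d i (Suc j)"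
    by (rule Suc.IH, rule Suc.prems, simp)+
  then show ?case by simp
qed simp

lemma neville_diff:
  "neville xs x (\<lambda>k. c k - d k) i j = neville xs x c i j - neville xs x d i j"
proof (induction i arbitrary: j)
  case (Suc i)
  show ?case
    unfolding neville.simps det22_eq Suc.IH by (simp only: algebra_simps)
qed simp

lemma neville_scale: "neville xs x (\<lambda>k. s * c k) i j = s * neville xs x c i j"
  by (induction i arbitrary: j) (simp_all add: det22_eq algebra_simps)

lemma neville_sum:
  "neville xs x (\<lambda>k. \<Sum>s\<in>S. c s k) i j = (\<Sum>s\<in>S. neville xs x (c s) i j)"
  by (induction i arbitrary: j)
    (simp, simp only: neville.simps det22_eq sum_distrib_left sum_distrib_right sum_subtractf[symmetric])

text \<open>The column for exponent 0 is constantly 1, so its interpolant is 1. This is the constant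
  term that inverting the series by \<open>coeff_a\<close> requires.\<close>

lemma N_val_0:
  assumes "inj_on xs {..n}"
  shows "N_val xs n x 0 = 1"
  using neville_eq_poly[OF assms, of 1 x] by (simp add: N_val_def)

subsection \<open>Generalised Rolle theorem\<close>

text \<open>Each gap between consecutive zeros yields a zero of the derivative strictly inside it.
  Disjointness from \<open>Z\<close> is recorded so that the new zeros can later be counted
  separately from a multiple zero.\<close>

lemma Rolle_zeros:
  fixes h h' :: "real \<Rightarrow> real"
  assumes "\<And>y. y \<in> {a..b} \<Longrightarrow> (h has_real_derivative h' y) (at y within {a..b})"
    and "Z \<subseteq> {a..b}" "card Z = Suc m" "\<And>z. z \<in> Z \<Longrightarrow> h z = 0"
  shows "\<exists>Z'. finite Z' \<and> Z' \<subseteq> {a..b} \<and> card Z' = m \<and> Z' \<inter> Z = {} \<and> (\<forall>z\<in>Z'. h' z = 0)"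
  using assms
proof (induction m arbitrary: b Z)
  case 0
  show ?case by (intro exI[of _ "{}"]) auto
next
  case (Suc m)
  have fin: "finite Z"
    using Suc.prems(3) card.infinite by fastforce
  define M where "M = Max Z"
  define Z0 where "Z0 = Z - {M}"
  have "Z \<noteq> {}" using Suc.prems(3) by auto
  then have M: "M \<in> Z" unfolding M_def using fin by (intro Max_in)
  have card0: "card Z0 = Suc m"
    using Suc.prems(3) M fin by (simp add: Z0_def)
  then have ne0: "Z0 \<noteq> {}" by auto
  define M0 where "M0 = Max Z0"
  have fin0: "finite Z0" using fin by (simp add: Z0_def)
  have M0: "M0 \<in> Z0" unfolding M0_def using fin0 ne0 by (intro Max_in)
  have le0: "z \<le> M0" if "z \<in> Z0" for z
    using fin0 that by (simp add: M0_def)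
  have "M0 \<le> M" using M0 fin by (auto simp: M_def Z0_def)
  then have lt: "M0 < M" using M0 by (auto simp: Z0_def)
  have bounds: "a \<le> M0" "M \<le> b" using M M0 Suc.prems(2) by (auto simp: Z0_def)
  \<comment> \<open>The largest zero \<open>M\<close> is removed and the interval is cut at the next
    largest \<open>M0\<close>; the open gap from \<open>M0\<close> to \<open>M\<close> then supplies
    one further zero, to the right of all of \<open>Z'\<close>.\<close>
  have "\<exists>Z'. finite Z' \<and> Z' \<subseteq> {a..M0} \<and> card Z' = m \<and> Z' \<inter> Z0 = {} \<and> (\<forall>z\<in>Z'. h' z = 0)"
  proof (rule Suc.IH)
    fix y assume "y \<in> {a..M0}"
    then show "(h has_real_derivative h' y) (at y within {a..M0})"
      using bounds lt by (intro DERIV_subset[OF Suc.prems(1)]) auto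
  next
    show "Z0 \<subseteq> {a..M0}"
      using Suc.prems(2) le0 unfolding Z0_def by fastforce
  qed (use Suc.prems(4) card0 in \<open>auto simp: Z0_def\<close>)
  then obtain Z' where Z': "finite Z'" "Z' \<subseteq> {a..M0}" "card Z' = m" "Z' \<inter> Z0 = {}" "\<And>z. z \<in> Z' \<Longrightarrow> h' z = 0"
    by blast
  have D: "(h has_real_derivative h' y) (at y)" if "M0 < y" "y < M" for y
    using Suc.prems(1)[of y] that bounds by (simp add: at_within_Icc_at)
  have "\<exists>z. M0 < z \<and> z < M \<and> h' z = 0"
  proof -
    have "continuous_on {a..b} h"
      using Suc.prems(1) by (rule DERIV_continuous_on)
    then have "continuous_on {M0..M} h"
      by (rule continuous_on_subset) (use bounds in auto)
    moreover have "h M0 = h M" using Suc.prems(4) M M0 by (simp add: Z0_def)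
    ultimately obtain z where z: "M0 < z" "z < M" "DERIV h z :> 0"
      using Rolle[OF lt] D real_differentiable_def by metis
    then show ?thesis using D DERIV_unique by blast
  qed
  then obtain z where z: "M0 < z" "z < M" "h' z = 0" by blast
  have zZ: "z \<notin> Z" "z \<notin> Z'" using z Z'(2) le0 by (fastforce simp: Z0_def)+
  have MZ: "M \<notin> Z'" using lt Z'(2) by auto
  show ?case
    using z Z' zZ MZ bounds lt by (intro exI[of _ "insert z Z'"]) (auto simp: Z0_def)
qed

text \<open>Here \<open>g k\<close> plays the role of the \<open>k\<close>-th derivative. While
  \<open>k \<le> r\<close>, the forced zero at \<open>x\<close> joins \<open>n + 1\<close> others,
  and Rolle gives \<open>n + 1\<close> zeros of \<open>g (Suc k)\<close> away from \<open>x\<close>,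
  so the count does not drop.\<close>

lemma confluent_Rolle:
  fixes g :: "nat \<Rightarrow> real \<Rightarrow> real"
  assumes D: "\<And>k y. k \<le> r + n \<Longrightarrow> y \<in> {a..b} \<Longrightarrow>
      (g k has_real_derivative g (Suc k) y) (at y within {a..b})"
    and x: "x \<in> {a..b}" "\<And>k. k \<le> r \<Longrightarrow> g k x = 0"
    and Z: "Z \<subseteq> {a..b}" "card Z = Suc n" "x \<notin> Z" "\<And>z. z \<in> Z \<Longrightarrow> g 0 z = 0"
  shows "\<exists>\<xi>\<in>{a..b}. g (r + n + 1) \<xi> = 0"
proof -
  have "\<exists>Z. finite Z \<and> Z \<subseteq> {a..b} \<and> card Z = Suc n \<and> x \<notin> Z \<and> (\<forall>z\<in>Z. g k z = 0)" if "k \<le> r" for k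
    using that
  proof (induction k)
    case 0
    have "finite Z" using Z(2) card.infinite by fastforce
    then show ?case using Z by blast
  next
    case (Suc k)
    then obtain Z where Z: "finite Z" "Z \<subseteq> {a..b}" "card Z = Suc n" "x \<notin> Z" "\<And>z. z \<in> Z \<Longrightarrow> g k z = 0"
      by auto
    have "\<exists>Z'. finite Z' \<and> Z' \<subseteq> {a..b} \<and> card Z' = Suc n \<and> Z' \<inter> insert x Z = {} \<and>
        (\<forall>z\<in>Z'. g (Suc k) z = 0)"
      by (rule Rolle_zeros[of a b "g k"]) (use Z x Suc.prems D in auto)
    then show ?case by blast
  qed
  from this[of r] obtain Z where
    Z: "finite Z" "Z \<subseteq> {a..b}" "card Z = Suc n" "x \<notin> Z" "\<And>z. z \<in> Z \<Longrightarrow> g r z = 0"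
    by auto
  \<comment> \<open>Beyond \<open>g r\<close> no zero at \<open>x\<close> is available, so each
    further derivative costs one zero: \<open>n + 1\<close> zeros of \<open>g (Suc r)\<close> shrink
    to a single one of \<open>g (Suc (r + n))\<close>.\<close>
  have "\<exists>Z. Z \<subseteq> {a..b} \<and> card Z = Suc (n - j) \<and> (\<forall>z\<in>Z. g (Suc (r + j)) z = 0)" if "j \<le> n" for j
    using that
  proof (induction j)
    case 0
    have "\<exists>Z'. finite Z' \<and> Z' \<subseteq> {a..b} \<and> card Z' = Suc n \<and> Z' \<inter> insert x Z = {} \<and>
        (\<forall>z\<in>Z'. g (Suc r) z = 0)"
      by (rule Rolle_zeros[of a b "g r"]) (use Z x D in auto)
    then show ?case by auto
  next
    case (Suc j)
    then obtain Z where Z: "Z \<subseteq> {a..b}" "card Z = Suc (n - j)" "\<And>z. z \<in> Z \<Longrightarrow> g (Suc (r + j)) z = 0"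
      by auto
    have "\<exists>Z'. finite Z' \<and> Z' \<subseteq> {a..b} \<and> card Z' = n - j \<and> Z' \<inter> Z = {} \<and>
        (\<forall>z\<in>Z'. g (Suc (Suc (r + j))) z = 0)"
      by (rule Rolle_zeros[of a b "g (Suc (r + j))"]) (use Z Suc.prems D in auto)
    moreover have "n - j = Suc (n - Suc j)" using Suc.prems by simp
    ultimately show ?case by auto
  qed
  from this[of n] obtain Z where Z: "Z \<subseteq> {a..b}" "card Z = Suc 0" "\<And>z. z \<in> Z \<Longrightarrow> g (Suc (r + n)) z = 0"
    by auto
  then show ?thesis by (auto simp: card_1_singleton_iff)
qed

subsection \<open>The relations between the Taylor coefficients\<close>

lemma poly_higher_pderiv_0: "poly ((pderiv ^^ k) p) 0 = fact k * coeff (p :: real poly) k"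
  by (simp add: poly_0_coeff_0 coeff_higher_pderiv pochhammer_fact)

lemma poly_higher_pderiv_top:
  fixes p :: "real poly"
  assumes "degree p \<le> m"
  shows "poly ((pderiv ^^ m) p) y = fact m * coeff p m"
proof -
  have "degree ((pderiv ^^ m) p) = 0"
    using assms by (simp add: degree_higher_pderiv)
  then obtain c where "(pderiv ^^ m) p = [:c:]"
    by (rule degree_eq_zeroE)
  then show ?thesis
    using poly_higher_pderiv_0[of m p] by simp
qed

text \<open>Confluent Rolle is applied to the difference of the function and its Hermite interpolant
  \<open>H\<close>. Since \<open>H\<close> has degree at most \<open>r + n + 1\<close>, its
  derivative of that order is a constant, fixed by the top coefficient of \<open>Q\<close>.\<close>

lemma hermite_remainder:
  fixes g :: "nat \<Rightarrow> real \<Rightarrow> real" and Q :: "real poly"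
  assumes D: "\<And>k y. k \<le> r + n \<Longrightarrow> y \<in> {a..b} \<Longrightarrow>
      (g k has_real_derivative g (Suc k) y) (at y within {a..b})"
    and x: "x \<in> {a..b}" and xs: "\<And>i. i \<le> n \<Longrightarrow> xs i \<in> {a..b}" "inj_on xs {..n}" "\<And>i. i \<le> n \<Longrightarrow> x \<noteq> xs i"
    and Q: "degree Q \<le> n" "\<And>i. i \<le> n \<Longrightarrow>
      g 0 (xs i) = (\<Sum>s\<le>r. g s x / fact s * (xs i - x) ^ s) + (xs i - x) ^ Suc r * poly Q (xs i - x)"
  shows "\<exists>\<xi>\<in>{a..b}. g (r + n + 1) \<xi> / fact (r + n + 1) = coeff Q n"
proof -
  define T where "T = (\<Sum>s\<le>r. monom (g s x / fact s) s)"
  define H where "H = T + monom 1 (Suc r) * Q"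
  have coeffT: "coeff T k = (if k \<le> r then g k x / fact k else 0)" for k
    by (simp add: T_def coeff_sum)
  \<comment> \<open>The Taylor part fills degrees up to \<open>r\<close>, and \<open>Q\<close> is
    shifted past it by \<open>Suc r\<close>; hence \<open>h k\<close> vanishes at \<open>x\<close>
    for \<open>k \<le> r\<close>.\<close>
  have coeffH: "coeff H k = (if k \<le> r then g k x / fact k else coeff Q (k - Suc r))" for k
    by (auto simp: H_def coeffT coeff_monom_mult)
  have degH: "degree H \<le> r + n + 1"
    by (rule degree_le) (use Q(1) in \<open>auto simp: coeffH coeff_eq_0\<close>)
  define h where "h k y = g k y - poly ((pderiv ^^ k) H) (y - x)" for k y
  have "\<exists>\<xi>\<in>{a..b}. h (r + n + 1) \<xi> = 0"
  proof (rule confluent_Rolle[where Z = "xs ` {..n}"])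
    fix k y assume "k \<le> r + n" "y \<in> {a..b}"
    have "((\<lambda>y. poly ((pderiv ^^ k) H) (y - x)) has_real_derivative
        poly (pderiv ((pderiv ^^ k) H)) (y - x) * 1) (at y within {a..b})"
      by (rule DERIV_chain2[OF poly_DERIV]) (auto intro!: derivative_eq_intros)
    with D[OF \<open>k \<le> r + n\<close> \<open>y \<in> {a..b}\<close>]
    show "(h k has_real_derivative h (Suc k) y) (at y within {a..b})"
      unfolding h_def by (intro DERIV_diff) auto
  next
    fix z assume "z \<in> xs ` {..n}"
    then show "h 0 z = 0"
      by (auto simp: h_def H_def T_def Q(2) poly_sum poly_monom)
  qed (use x xs in \<open>auto simp: h_def poly_higher_pderiv_0 coeffH card_image\<close>)
  then obtain \<xi> where \<xi>: "\<xi> \<in> {a..b}" "h (r + n + 1) \<xi> = 0" by blast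
  have "g (r + n + 1) \<xi> = fact (r + n + 1) * coeff Q n"
    using \<xi>(2) unfolding h_def poly_higher_pderiv_top[OF degH] by (simp add: coeffH)
  with \<xi>(1) show ?thesis by (intro bexI[of _ \<xi>]) simp_all
qed

text \<open>
  The value at \<open>x\<close> of the interpolant of \<open>(x\<^sub>i - x) * Q(x\<^sub>i)\<close> only sees the leading coefficient
  of \<open>Q\<close>: the interpolant is \<open>(y - x) * Q(y) - coeff Q n * (\<Prod>i\<le>n. y - x\<^sub>i)\<close>.
\<close>

lemma neville_times_node:
  fixes Q :: "real poly"
  assumes "inj_on xs {..n}" "degree Q \<le> n"
  shows "neville xs x (\<lambda>i. (xs i - x) * poly Q (xs i - x)) n 0 = - coeff Q n * (\<Prod>i\<le>n. x - xs i)"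
proof -
  define W where "W = (\<Prod>i\<le>n. [:- (xs i - x), 1:])"
  define P where "P = [:0, 1:] * Q - smult (coeff Q n) W"
  have degW: "degree W = Suc n"
    unfolding W_def by (subst degree_prod_eq_sum_degree) auto
  have "lead_coeff W = 1"
    unfolding W_def by (simp add: lead_coeff_prod)
  then have "coeff W (Suc n) = 1" by (simp add: degW)
  \<comment> \<open>\<open>W\<close> is monic of degree \<open>Suc n\<close>, so subtracting
    \<open>coeff Q n\<close> times \<open>W\<close> cancels the only possible term of degree
    \<open>Suc n\<close> in \<open>[:0, 1:] * Q\<close>.\<close>
  then have "coeff P k = 0" if "k > n" for k
    using that assms(2) degW by (cases "k = Suc n") (auto simp: P_def coeff_eq_0 coeff_pCons split: nat.split)
  then have degP: "degree P \<le> n" by (intro degree_le) auto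
  have "poly W (xs i - x) = 0" if "i \<le> n" for i
    using that by (auto simp: W_def poly_prod)
  then have "neville xs x (\<lambda>i. (xs i - x) * poly Q (xs i - x)) n 0 = poly P 0"
    by (intro neville_eq_poly[OF assms(1) degP]) (simp add: P_def)
  also have "\<dots> = - coeff Q n * (\<Prod>i\<le>n. x - xs i)"
    by (simp add: P_def W_def poly_prod)
  finally show ?thesis .
qed

text \<open>Dividing the Taylor polynomial by \<open>(xs i - x) ^ r\<close> turns it into a
  combination of the columns \<open>1 / (xs i - x) ^ (r - s)\<close>. Linearity of the scheme thus
  turns the Hermite remainder formula into a relation between \<open>N_val\<close> and
  \<open>N_tilde\<close>.\<close>

lemma taylor_neville_remainder:
  fixes g :: "nat \<Rightarrow> real \<Rightarrow> real"
  assumes D: "\<And>k y. k \<le> r + n \<Longrightarrow> y \<in> {a..b} \<Longrightarrow>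
      (g k has_real_derivative g (Suc k) y) (at y within {a..b})"
    and x: "x \<in> {a..b}" and xs: "\<And>i. i \<le> n \<Longrightarrow> xs i \<in> {a..b}" "inj_on xs {..n}" "\<And>i. i \<le> n \<Longrightarrow> x \<noteq> xs i"
  shows "\<exists>\<xi>\<in>{a..b}. (\<Sum>s\<le>r. g s x / fact s * N_val xs n x (r - s)) =
    N_tilde (g 0) xs n x r + (\<Prod>i\<le>n. x - xs i) * (g (r + n + 1) \<xi> / fact (r + n + 1))"
proof -
  define T where "T y = (\<Sum>s\<le>r. g s x / fact s * (y - x) ^ s)" for y
  \<comment> \<open>\<open>Q\<close> interpolates the Taylor remainder divided by
    \<open>(xs i - x) ^ Suc r\<close>, exactly the factor left for it in the Hermite
    interpolant.\<close>
  obtain Q where Q: "degree Q \<le> n"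
    "\<And>i. i \<le> n \<Longrightarrow> poly Q (xs i - x) = (g 0 (xs i) - T (xs i)) / (xs i - x) ^ Suc r"
    using neville_interpolation[of xs 0 n x "\<lambda>i. (g 0 (xs i) - T (xs i)) / (xs i - x) ^ Suc r"] xs(2)
    by (auto simp: atLeast0AtMost)
  have "g 0 (xs i) = (\<Sum>s\<le>r. g s x / fact s * (xs i - x) ^ s) + (xs i - x) ^ Suc r * poly Q (xs i - x)"
    if "i \<le> n" for i
    using xs(3)[OF that] unfolding Q(2)[OF that] by (simp add: T_def)
  from hermite_remainder[of r n a b g x xs Q, OF D x xs Q(1) this]
  obtain \<xi> where \<xi>: "\<xi> \<in> {a..b}" "g (r + n + 1) \<xi> / fact (r + n + 1) = coeff Q n"
    by blast
  have "- coeff Q n * (\<Prod>i\<le>n. x - xs i) = neville xs x (\<lambda>i. (xs i - x) * poly Q (xs i - x)) n 0"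
    by (rule neville_times_node[OF xs(2) Q(1), symmetric])
  also have "\<dots> = neville xs x (\<lambda>i. g 0 (xs i) / (xs i - x) ^ r -
      (\<Sum>s\<le>r. g s x / fact s * (1 / (xs i - x) ^ (r - s)))) n 0"
  proof (rule neville_cong)
    fix i assume "i \<in> {0..n + 0}"
    then have i: "i \<le> n" by simp
    then have ne: "xs i - x \<noteq> 0" using xs(3) by force
    have "(xs i - x) * poly Q (xs i - x) = g 0 (xs i) / (xs i - x) ^ r - T (xs i) / (xs i - x) ^ r"
      using ne by (simp add: Q(2)[OF i] diff_divide_distrib right_diff_distrib)
    also have "T (xs i) / (xs i - x) ^ r = (\<Sum>s\<le>r. g s x / fact s * (1 / (xs i - x) ^ (r - s)))"
      unfolding T_def sum_divide_distrib
      by (intro sum.cong refl) (use ne in \<open>simp add: power_diff\<close>)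
    finally show "(xs i - x) * poly Q (xs i - x) = g 0 (xs i) / (xs i - x) ^ r -
      (\<Sum>s\<le>r. g s x / fact s * (1 / (xs i - x) ^ (r - s)))" .
  qed
  also have "\<dots> = N_tilde (g 0) xs n x r - (\<Sum>s\<le>r. g s x / fact s * N_val xs n x (r - s))"
    unfolding neville_diff neville_sum neville_scale by (simp add: N_tilde_def N_val_def)
  finally show ?thesis
    using \<xi> by (intro bexI[of _ \<xi>]) (simp_all add: mult.commute)
qed

section \<open>Convolution with the reciprocal power series\<close>

lemma coeff_a_reciprocal:
  assumes "M 0 = 1"
  shows "(\<Sum>k\<le>m. coeff_a M k * M (m - k)) = (if m = 0 then 1 else 0)"
proof -
  have "(\<Sum>k\<le>m. coeff_a M k * M (m - k)) = (\<Sum>k<m. coeff_a M k * M (m - k)) + coeff_a M m"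
    using assms by (simp add: lessThan_Suc_atMost[symmetric])
  \<comment> \<open>The recursion is unfolded only at the isolated \<open>coeff_a M m\<close>, which
    cancels the remaining sum when \<open>m\<close> is positive.\<close>
  then show ?thesis
    by (subst (asm) (3) coeff_a.simps) simp
qed

lemma coeff_a_deconvolution:
  assumes "M 0 = 1"
  shows "(\<Sum>k\<le>t. coeff_a M k * (\<Sum>s\<le>t - k. F s * M (t - k - s))) = F t"
proof -
  \<comment> \<open>The inner range becomes the symmetric condition \<open>k + s \<le> t\<close>, so
    that the triangular double sum can be transposed; the reciprocal identity then leaves only
    \<open>s = t\<close>.\<close>
  have "(\<Sum>k\<le>t. coeff_a M k * (\<Sum>s\<le>t - k. F s * M (t - k - s))) =
      (\<Sum>k\<in>{..t}. \<Sum>s | s \<in> {..t} \<and> k + s \<le> t. F s * (coeff_a M k * M (t - s - k)))"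
    unfolding sum_distrib_left
    by (intro sum.cong refl) (auto simp: algebra_simps)
  also have "\<dots> = (\<Sum>s\<in>{..t}. \<Sum>k | k \<in> {..t} \<and> k + s \<le> t. F s * (coeff_a M k * M (t - s - k)))"
    by (rule sum.swap_restrict) auto
  also have "\<dots> = (\<Sum>s\<le>t. F s * (\<Sum>k\<le>t - s. coeff_a M k * M (t - s - k)))"
    unfolding sum_distrib_left by (intro sum.cong refl) auto
  also have "\<dots> = (\<Sum>s\<le>t. if s = t then F s else 0)"
    unfolding coeff_a_reciprocal[of M, OF assms] by (intro sum.cong refl) auto
  finally show ?thesis by simp
qed

section \<open>Derivatives relative to the interval, and assembly\<close>

lemma nderiv_on_has_derivative:
  assumes "Ck_on m {p..q} f" "p < q" "k < m" "y \<in> {p..q}"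
  shows "(nderiv_on {p..q} k f has_real_derivative nderiv_on {p..q} (Suc k) f y) (at y within {p..q})"
proof -
  have "nderiv_on {p..q} k f differentiable (at y within {p..q})"
    using assms(1,3,4) by (auto simp: Ck_on_def differentiable_on_def)
  then show ?thesis
    by (simp add: vector_derivative_works has_real_derivative_iff_has_vector_derivative)
qed

theorem theorem4p2:
  fixes n t :: nat and p q x :: real and xs :: "nat \<Rightarrow> real" and f :: "real \<Rightarrow> real"
  assumes "x \<in> {p..q}" and "\<And>i. i \<le> n \<Longrightarrow> xs i \<in> {p..q}"
    and "inj_on xs {..n}" and "\<And>i. i \<le> n \<Longrightarrow> x \<noteq> xs i"
    and "Ck_on (n + t + 1) {p..q} f"
  defines "I \<equiv> smallest_closed_interval (insert x (xs ` {..n}))"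
    and "a \<equiv> coeff_a (N_val xs n x)"
    and "b \<equiv> coeff_a (A_val xs n x)"
  shows "(\<exists>\<xi> :: nat \<Rightarrow> real. (\<forall>k\<le>t. \<xi> k \<in> I) \<and>
            nderiv_on {p..q} t f x / fact t =
              (\<Sum>k\<le>t. a k * N_tilde f xs n x (t - k)) +
              (\<Prod>i\<le>n. x - xs i) *
                (\<Sum>k\<le>t. a k * (nderiv_on {p..q} (t - k + n + 1) f (\<xi> k) / fact (t - k + n + 1))))
       \<and> (\<exists>\<xi> :: nat \<Rightarrow> real. (\<forall>k\<le>t. \<xi> k \<in> I) \<and>
            nderiv_on {p..q} t f x / fact t =
              (\<Sum>k\<le>t. b k * A_tilde f xs n x (t - k)) +
              (\<Prod>i\<le>n. x - xs i) *
                (\<Sum>k\<le>t. b k * (nderiv_on {p..q} (t - k + n + 1) f (\<xi> k) / fact (t - k + n + 1))))"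
proof -
  have N: "A_val xs n x = N_val xs n x" "A_tilde f xs n x = N_tilde f xs n x"
    by (rule ext, simp add: A_val_def N_val_def A_tilde_def N_tilde_def aitken_eq_neville[OF assms(3)])+
  let ?X = "insert x (xs ` {..n})"
  define l u where "l = Min ?X" and "u = Max ?X"
  have I: "I = {l..u}"
    unfolding I_def l_def u_def by (rule smallest_closed_interval_eq) auto
  have sub: "{l..u} \<subseteq> {p..q}"
    using assms(1,2) Min_in[of ?X] Max_in[of ?X] unfolding l_def u_def by fastforce
  have "p < q"
    using assms(1) assms(2,4)[of 0] by fastforce
  have in_lu: "y \<in> {l..u}" if "y \<in> ?X" for y
    unfolding l_def u_def atLeastAtMost_iff
    using that by (intro conjI Min_le Max_ge) auto
  define F where "F s = nderiv_on {p..q} s f x / fact s" for s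
  have rel: "\<exists>\<xi>\<in>I. (\<Sum>s\<le>r. F s * N_val xs n x (r - s)) = N_tilde f xs n x r +
      (\<Prod>i\<le>n. x - xs i) * (nderiv_on {p..q} (r + n + 1) f \<xi> / fact (r + n + 1))" if "r \<le> t" for r
  proof -
    \<comment> \<open>The derivatives are those within \<open>{p..q}\<close>, merely restricted to
      \<open>{l..u}\<close>; working on the smaller interval is what places the Rolle point in
      \<open>I\<close>.\<close>
    have D: "(nderiv_on {p..q} k f has_real_derivative nderiv_on {p..q} (Suc k) f y) (at y within {l..u})"
      if "k \<le> r + n" "y \<in> {l..u}" for k y
      by (rule DERIV_subset[OF nderiv_on_has_derivative[OF assms(5) \<open>p < q\<close>] sub])
        (use that \<open>r \<le> t\<close> sub in auto)
    have "x \<in> {l..u}" "\<And>i. i \<le> n \<Longrightarrow> xs i \<in> {l..u}"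
      by (rule in_lu, simp)+
    then show ?thesis
      using taylor_neville_remainder[of r n l u "\<lambda>k. nderiv_on {p..q} k f" x xs, OF D _ _ assms(3,4)]
      unfolding F_def I nderiv_on.simps(1) by blast
  qed
  \<comment> \<open>The coefficient \<open>a k\<close> is paired with the relation of order
    \<open>r = t - k\<close>, and one point is chosen for each \<open>k\<close>.\<close>
  have "\<exists>\<xi>. \<forall>k\<in>{..t}. \<xi> k \<in> I \<and> (\<Sum>s\<le>t - k. F s * N_val xs n x (t - k - s)) = N_tilde f xs n x (t - k) +
      (\<Prod>i\<le>n. x - xs i) * (nderiv_on {p..q} (t - k + n + 1) f (\<xi> k) / fact (t - k + n + 1))"
    by (rule bchoice) (use rel[OF diff_le_self] in blast)
  then obtain \<xi> where \<xi>: "\<And>k. k \<le> t \<Longrightarrow> \<xi> k \<in> I"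
    "\<And>k. k \<le> t \<Longrightarrow> (\<Sum>s\<le>t - k. F s * N_val xs n x (t - k - s)) = N_tilde f xs n x (t - k) +
      (\<Prod>i\<le>n. x - xs i) * (nderiv_on {p..q} (t - k + n + 1) f (\<xi> k) / fact (t - k + n + 1))"
    by blast
  have "F t = (\<Sum>k\<le>t. a k * (\<Sum>s\<le>t - k. F s * N_val xs n x (t - k - s)))"
    unfolding a_def by (rule coeff_a_deconvolution[where M = "N_val xs n x", OF N_val_0[OF assms(3)], symmetric])
  also have "\<dots> = (\<Sum>k\<le>t. a k * N_tilde f xs n x (t - k) +
      (\<Prod>i\<le>n. x - xs i) * (a k * (nderiv_on {p..q} (t - k + n + 1) f (\<xi> k) / fact (t - k + n + 1))))"
    by (rule sum.cong[OF refl]) (simp only: \<xi>(2) atMost_iff distrib_left mult.left_commute)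
  also have "\<dots> = (\<Sum>k\<le>t. a k * N_tilde f xs n x (t - k)) + (\<Prod>i\<le>n. x - xs i) *
      (\<Sum>k\<le>t. a k * (nderiv_on {p..q} (t - k + n + 1) f (\<xi> k) / fact (t - k + n + 1)))"
    by (simp only: sum.distrib sum_distrib_left)
  finally have "\<exists>\<xi>. (\<forall>k\<le>t. \<xi> k \<in> I) \<and> F t = (\<Sum>k\<le>t. a k * N_tilde f xs n x (t - k)) +
      (\<Prod>i\<le>n. x - xs i) *
      (\<Sum>k\<le>t. a k * (nderiv_on {p..q} (t - k + n + 1) f (\<xi> k) / fact (t - k + n + 1)))"
    using \<xi>(1) by blast
  moreover have "b = a" by (simp add: a_def b_def N)
  ultimately show ?thesis
    unfolding N F_def by simp
qed

end
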